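(* For all $k\ge2$, the monoid $\mathsf{tot}M_{k,1}$ is congruence-simple.
   Context: Let $A$ be an alphabet with $|A|=k$. A prefix code in $A^*$ is a set of strings none of which is a proper prefix of another; it is maximal if it is not properly contained in another prefix code. A right-ideal morphism of $A^*$ is a partial function $f:A^*\to A^*$ whose domain is a right ideal (a set $R$ with $R=RA^*$) and such that $f(xu)=f(x)u$ for all $x\in\mathrm{Dom}(f)$, $u\in A^*$; $\mathrm{domC}(f)$ is the unique prefix code with $\mathrm{Dom}(f)=\mathrm{domC}(f)A^*$. $\mathcal{RM}_k^{\mathsf{fin}}$ is the monoid under composition of right-ideal morphisms with finite domain code, and $\mathsf{tot}\mathcal{RM}_k^{\mathsf{fin}}$ is the submonoid of those $f$ for which $\mathrm{domC}(f)$ is a maximal prefix code. $f\equiv_{\rm fin}g$ iff the symmetric difference of $\mathrm{Dom}(f)$ and $\mathrm{Dom}(g)$ is finite and $f,g$ agree on $\mathrm{Dom}(f)\cap\mathrm{Dom}(g)$; this is a congruence. $\mathsf{tot}M_{k,1}=\mathsf{tot}\mathcal{RM}_k^{\mathsf{fin}}/\!\equiv_{\rm fin}$. Equivalently, $\mathsf{tot}M_{k,1}$ is the monoid of all total functions $A^\omega\to A^\omega$ of the form $pz\mapsto f(p)z$ ($p\in P$, $z\in A^\omega$), where $P$ is a finite maximal prefix code and $f:P\to A^*$ is any function. A monoid is congruence-simple if its only congruences are equality and the universal congruence. *)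

theory Defs
  imports "HOL-Algebra.Group" "HOL-Library.Sublist" "HOL-Library.Cardinality"
begin

section \<open>Monoid congruences and quotients\<close>

definition monoid_congruence :: "('m, 'z) monoid_scheme \<Rightarrow> ('m \<times> 'm) set \<Rightarrow> bool" where
  "monoid_congruence M r \<longleftrightarrow> equiv (carrier M) r \<and>
     (\<forall>(x, x') \<in> r. \<forall>(y, y') \<in> r. (x \<otimes>\<^bsub>M\<^esub> y, x' \<otimes>\<^bsub>M\<^esub> y') \<in> r)"

definition congruence_simple :: "('m, 'z) monoid_scheme \<Rightarrow> bool" where
  "congruence_simple M \<longleftrightarrow> monoid M \<and>
     (\<forall>r. monoid_congruence M r \<longrightarrow> r = Id_on (carrier M) \<or> r = carrier M \<times> carrier M)"

definition quotient_monoid :: "('m, 'z) monoid_scheme \<Rightarrow> ('m \<times> 'm) set \<Rightarrow> 'm set monoid" where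
  "quotient_monoid M r =
     \<lparr>carrier = carrier M // r,
      mult = (\<lambda>X Y. \<Union>x\<in>X. \<Union>y\<in>Y. r `` {x \<otimes>\<^bsub>M\<^esub> y}),
      one = r `` {\<one>\<^bsub>M\<^esub>}\<rparr>"

section \<open>Prefix codes and right-ideal morphisms\<close>

text \<open>The alphabet \<open>A\<close> is a finite type \<open>'a\<close>, so that \<open>A\<^sup>*\<close> is the type \<open>'a list\<close>, and
  \<open>k\<close> is \<open>CARD('a)\<close>. A partial function on \<open>A\<^sup>*\<close> is a map \<open>'a list \<rightharpoonup> 'a list\<close>.\<close>

definition prefix_code :: "'a list set \<Rightarrow> bool" where
  "prefix_code P \<longleftrightarrow> (\<forall>p\<in>P. \<forall>q\<in>P. \<not> strict_prefix p q)"

definition maximal_prefix_code :: "'a list set \<Rightarrow> bool" where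
  "maximal_prefix_code P \<longleftrightarrow> prefix_code P \<and> \<not> (\<exists>Q. prefix_code Q \<and> P \<subset> Q)"

text \<open>The set \<open>R A\<^sup>*\<close>:\<close>

definition right_gen :: "'a list set \<Rightarrow> 'a list set" where
  "right_gen R = {x @ u |x u. x \<in> R}"

definition right_ideal :: "'a list set \<Rightarrow> bool" where
  "right_ideal R \<longleftrightarrow> R = right_gen R"

definition right_ideal_morphism :: "('a list \<rightharpoonup> 'a list) \<Rightarrow> bool" where
  "right_ideal_morphism f \<longleftrightarrow> right_ideal (dom f) \<and>
     (\<forall>x\<in>dom f. \<forall>u. f (x @ u) = Some (the (f x) @ u))"

definition domC :: "('a list \<rightharpoonup> 'a list) \<Rightarrow> 'a list set" where
  "domC f = (THE P. prefix_code P \<and> dom f = right_gen P)"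

definition RM_fin :: "('a list \<rightharpoonup> 'a list) set" where
  "RM_fin = {f. right_ideal_morphism f \<and> finite (domC f)}"

definition tot_RM_fin :: "('a list \<rightharpoonup> 'a list) set" where
  "tot_RM_fin = {f \<in> RM_fin. maximal_prefix_code (domC f)}"

definition tot_RM_fin_monoid :: "('a list \<rightharpoonup> 'a list) monoid" where
  "tot_RM_fin_monoid = \<lparr>carrier = tot_RM_fin, mult = (\<circ>\<^sub>m), one = Some\<rparr>"

definition equiv_fin :: "('a list \<rightharpoonup> 'a list) \<Rightarrow> ('a list \<rightharpoonup> 'a list) \<Rightarrow> bool" where
  "equiv_fin f g \<longleftrightarrow> finite (sym_diff (dom f) (dom g)) \<and> (\<forall>x \<in> dom f \<inter> dom g. f x = g x)"

definition tot_M :: "('a list \<rightharpoonup> 'a list) set monoid" where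
  "tot_M = quotient_monoid tot_RM_fin_monoid
     {(f, g). f \<in> tot_RM_fin \<and> g \<in> tot_RM_fin \<and> equiv_fin f g}"

section \<open>Well-definedness\<close>

lemma mem_right_gen: "x \<in> right_gen P \<longleftrightarrow> (\<exists>p\<in>P. prefix p x)"
  by (auto simp: right_gen_def prefix_def)

lemma right_ideal_iff: "right_ideal R \<longleftrightarrow> (\<forall>x\<in>R. \<forall>u. x @ u \<in> R)"
proof
  assume "right_ideal R"
  then show "\<forall>x\<in>R. \<forall>u. x @ u \<in> R"
    unfolding right_ideal_def by (metis mem_right_gen prefix_def append_assoc)
next
  assume "\<forall>x\<in>R. \<forall>u. x @ u \<in> R"
  then show "right_ideal R"
    unfolding right_ideal_def by (auto simp: mem_right_gen prefix_def) (metis append_Nil2)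
qed

lemma prefix_code_unique:
  assumes "prefix_code P" "prefix_code Q" "right_gen P = right_gen Q"
  shows "P = Q"
proof -
  have *: "P \<subseteq> Q"
    if P: "prefix_code P" and eq: "right_gen P = right_gen Q" for P Q :: "'a list set"
  proof
    fix p assume p: "p \<in> P"
    then obtain q where q: "q \<in> Q" "prefix q p" using eq mem_right_gen by blast
    then obtain p' where p': "p' \<in> P" "prefix p' q" using eq mem_right_gen by blast
    have "p' = p"
      using P p p' q(2) unfolding prefix_code_def
      by (metis prefix_order.trans prefix_order.le_less)
    then show "p \<in> Q" using p' q prefix_order.antisym by blast
  qed
  show ?thesis using * assms by (metis subset_antisym)
qed

lemma right_ideal_prefix_code_ex:
  assumes "right_ideal R"
  shows "\<exists>P. prefix_code P \<and> R = right_gen P"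
proof -
  define P where "P = {x \<in> R. \<forall>y\<in>R. \<not> strict_prefix y x}"
  have "\<exists>p\<in>P. prefix p x" if "x \<in> R" for x
    using that
  proof (induction x rule: length_induct)
    case (1 x)
    show ?case
    proof (cases "x \<in> P")
      case False
      then obtain y where "y \<in> R" "strict_prefix y x" using 1 P_def by blast
      then show ?thesis
        using 1 by (meson prefix_length_less prefix_order.le_less prefix_order.trans)
    qed auto
  qed
  moreover have "x \<in> R" if "p \<in> P" "prefix p x" for p x
    using that assms by (auto simp: P_def right_ideal_iff prefix_def)
  ultimately have "R = right_gen P" by (auto simp: mem_right_gen)
  moreover have "prefix_code P" by (auto simp: P_def prefix_code_def)
  ultimately show ?thesis by blast
qed

lemma domC:
  assumes "right_ideal_morphism f"
  shows "prefix_code (domC f)" and "dom f = right_gen (domC f)"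
proof -
  have "\<exists>!P. prefix_code P \<and> dom f = right_gen P"
    using right_ideal_prefix_code_ex[of "dom f"] prefix_code_unique assms
    unfolding right_ideal_morphism_def by metis
  from theI'[OF this] show "prefix_code (domC f)" and "dom f = right_gen (domC f)"
    by (auto simp: domC_def)
qed

lemma finite_lists_length_less: "finite {x :: 'a::finite list. length x < n}"
  by (rule finite_subset[OF _ finite_lists_length_le[OF finite_class.finite_UNIV, of n]]) auto

lemma maximal_imp_cofinite:
  fixes P :: "'a::finite list set"
  assumes "finite P" "maximal_prefix_code P"
  shows "finite (- right_gen P)"
proof -
  define n where "n = Suc (Max (length ` P))"
  have n: "length p < n" if "p \<in> P" for p
    using that assms(1) by (simp add: n_def less_Suc_eq_le)
  have "- right_gen P \<subseteq> {x. length x < n}"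
  proof (rule ccontr)
    assume "\<not> ?thesis"
    then obtain x where x: "x \<notin> right_gen P" "n \<le> length x" by force
    have "\<not> strict_prefix p x" "\<not> strict_prefix x p" if "p \<in> P" for p
      using x n[OF that] that mem_right_gen prefix_order.less_imp_le
        prefix_length_less[of x p] by force+
    then have "prefix_code (insert x P)"
      using assms(2) by (auto simp: maximal_prefix_code_def prefix_code_def)
    moreover have "x \<notin> P" using x mem_right_gen by blast
    ultimately show False using assms(2) by (auto simp: maximal_prefix_code_def)
  qed
  then show ?thesis using finite_lists_length_less finite_subset by blast
qed

lemma cofinite_imp_maximal:
  fixes P :: "'a::finite list set"
  assumes P: "prefix_code P" and fin: "finite (- right_gen P)"
  shows "finite P" and "maximal_prefix_code P"
proof -
  have "P \<subseteq> insert [] ((\<lambda>(y, a). y @ [a]) ` ((- right_gen P) \<times> UNIV))"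
  proof
    fix p assume p: "p \<in> P"
    show "p \<in> insert [] ((\<lambda>(y, a). y @ [a]) ` ((- right_gen P) \<times> UNIV))"
    proof (cases p rule: rev_cases)
      case (snoc y a)
      have "y \<notin> right_gen P"
      proof
        assume "y \<in> right_gen P"
        then obtain q where "q \<in> P" "prefix q y" using mem_right_gen by blast
        moreover have "strict_prefix y p" using snoc by (simp add: strict_prefix_def)
        ultimately have "strict_prefix q p" by (metis prefix_order.le_less_trans)
        then show False using P p \<open>q \<in> P\<close> by (auto simp: prefix_code_def)
      qed
      then show ?thesis using snoc by force
    qed simp
  qed
  then show "finite P" by (rule finite_subset) (use fin in auto)
  have False if Q: "prefix_code Q" "P \<subset> Q" for Q
  proof -
    from Q obtain q where q: "q \<in> Q" "q \<notin> P" by blast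
    define h :: "nat \<Rightarrow> 'a list" where "h m = q @ replicate m undefined" for m
    have "inj h" by (auto simp: inj_def h_def)
    then have "infinite (range h)" by (simp add: finite_image_iff)
    then have "\<not> range h \<subseteq> - right_gen P" using fin finite_subset by metis
    then obtain m where "h m \<in> right_gen P" by blast
    then obtain p where p: "p \<in> P" "prefix p (h m)" using mem_right_gen by blast
    then have "prefix p q \<or> prefix q p"
      by (metis h_def prefix_same_cases prefixI)
    then show False using Q p q unfolding prefix_code_def strict_prefix_def by blast
  qed
  then show "maximal_prefix_code P" using P by (auto simp: maximal_prefix_code_def)
qed

lemma tot_RM_fin_iff:
  fixes f :: "'a::finite list \<rightharpoonup> 'a list"
  shows "f \<in> tot_RM_fin \<longleftrightarrow> right_ideal_morphism f \<and> finite (- dom f)"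
  using domC[of f] maximal_imp_cofinite[of "domC f"] cofinite_imp_maximal[of "domC f"]
  by (auto simp: tot_RM_fin_def RM_fin_def)

lemma right_ideal_morphism_iff:
  "right_ideal_morphism f \<longleftrightarrow> (\<forall>x y u. f x = Some y \<longrightarrow> f (x @ u) = Some (y @ u))"
  by (fastforce simp: right_ideal_morphism_def right_ideal_iff dom_def)

lemma tot_RM_fin_comp:
  fixes f g :: "'a::finite list \<rightharpoonup> 'a list"
  assumes f: "f \<in> tot_RM_fin" and g: "g \<in> tot_RM_fin"
  shows "f \<circ>\<^sub>m g \<in> tot_RM_fin"
proof -
  have f': "right_ideal_morphism f" "finite (- dom f)"
    and g': "right_ideal_morphism g" "finite (- dom g)"
    using f g by (auto simp: tot_RM_fin_iff)
  have "right_ideal_morphism (f \<circ>\<^sub>m g)"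
    using f'(1) g'(1) by (auto simp: right_ideal_morphism_iff map_comp_Some_iff)
  moreover have "- dom (f \<circ>\<^sub>m g) \<subseteq> - dom g \<union>
    (\<Union>p\<in>domC g. (\<lambda>u. p @ u) ` ((\<lambda>u. the (g p) @ u) -` (- dom f)))"
  proof
    fix x assume x: "x \<in> - dom (f \<circ>\<^sub>m g)"
    show "x \<in> - dom g \<union>
      (\<Union>p\<in>domC g. (\<lambda>u. p @ u) ` ((\<lambda>u. the (g p) @ u) -` (- dom f)))"
    proof (cases "x \<in> dom g")
      case True
      then obtain p u where p: "p \<in> domC g" "x = p @ u"
        using domC(2)[OF g'(1)] by (auto simp: right_gen_def)
      then have "p \<in> dom g"
        using domC(2)[OF g'(1)] by (auto simp: mem_right_gen)
      then have "g x = Some (the (g p) @ u)"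
        using g'(1) p by (auto simp: right_ideal_morphism_iff)
      then have "the (g p) @ u \<notin> dom f"
        using x by (auto simp: map_comp_def)
      then show ?thesis using p by blast
    qed simp
  qed
  moreover have "finite (domC g)" using g by (simp add: tot_RM_fin_def RM_fin_def)
  moreover have "finite ((\<lambda>u. the (g p) @ u) -` (- dom f))" for p
    by (rule finite_vimageI[OF f'(2)]) (simp add: inj_def)
  ultimately have "finite (- dom (f \<circ>\<^sub>m g))"
    using g'(2) by (elim finite_subset) simp
  then show ?thesis
    using \<open>right_ideal_morphism (f \<circ>\<^sub>m g)\<close> by (simp add: tot_RM_fin_iff)
qed

lemma monoid_tot_RM_fin: "monoid (tot_RM_fin_monoid :: ('a::finite list \<rightharpoonup> 'a list) monoid)"
proof
  show "\<one>\<^bsub>tot_RM_fin_monoid\<^esub> \<in> carrier (tot_RM_fin_monoid :: ('a list \<rightharpoonup> 'a list) monoid)"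
    by (simp add: tot_RM_fin_monoid_def tot_RM_fin_iff right_ideal_morphism_iff dom_def)
qed (auto simp: tot_RM_fin_monoid_def tot_RM_fin_comp, auto simp: map_comp_def fun_eq_iff split: option.split)

lemma equiv_fin_trans:
  fixes f g h :: "'a::finite list \<rightharpoonup> 'a list"
  assumes "f \<in> tot_RM_fin" "g \<in> tot_RM_fin" "h \<in> tot_RM_fin"
    and fg: "equiv_fin f g" and gh: "equiv_fin g h"
  shows "equiv_fin f h"
proof -
  have fin: "finite (- dom f)" "finite (- dom g)" "finite (- dom h)"
    and mor: "right_ideal_morphism f" "right_ideal_morphism h"
    using assms(1-3) by (auto simp: tot_RM_fin_iff)
  have "finite (sym_diff (dom f) (dom h))"
    using fin by (auto intro: rev_finite_subset)
  moreover have "f x = h x" if "x \<in> dom f \<inter> dom h" for x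
  proof -
    from that obtain y z where yz: "f x = Some y" "h x = Some z" by blast
    define e :: "nat \<Rightarrow> 'a list" where "e m = x @ replicate m undefined" for m
    have "inj e" by (auto simp: inj_def e_def)
    then have "infinite (range e)" by (simp add: finite_image_iff)
    then have "\<not> range e \<subseteq> - dom g" using fin(2) finite_subset by metis
    then obtain m where m: "e m \<in> dom g" by blast
    have *: "f (e m) = Some (y @ replicate m undefined)" "h (e m) = Some (z @ replicate m undefined)"
      using mor yz by (auto simp: right_ideal_morphism_iff e_def)
    moreover have "e m \<in> dom f" "e m \<in> dom h" using * by (simp_all add: domI)
    then have "f (e m) = g (e m)" "g (e m) = h (e m)"
      using fg gh m unfolding equiv_fin_def by blast+
    ultimately show ?thesis using yz by simp
  qed
  ultimately show ?thesis by (simp add: equiv_fin_def)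
qed

lemma monoid_congruence_equiv_fin:
  "monoid_congruence (tot_RM_fin_monoid :: ('a::finite list \<rightharpoonup> 'a list) monoid)
     {(f, g). f \<in> tot_RM_fin \<and> g \<in> tot_RM_fin \<and> equiv_fin f g}"
proof -
  let ?r = "{(f, g :: 'a list \<rightharpoonup> 'a list). f \<in> tot_RM_fin \<and> g \<in> tot_RM_fin \<and> equiv_fin f g}"
  have "equiv tot_RM_fin ?r"
  proof (rule equivI)
    show "trans ?r" by (rule transI) (use equiv_fin_trans in blast)
  qed (auto simp: refl_on_def sym_def equiv_fin_def Un_commute Int_commute)
  moreover have "equiv_fin (f \<circ>\<^sub>m g) (f' \<circ>\<^sub>m g')"
    if "f \<in> tot_RM_fin" "f' \<in> tot_RM_fin" "g \<in> tot_RM_fin" "g' \<in> tot_RM_fin"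
      and e: "equiv_fin f f'" "equiv_fin g g'" for f f' g g' :: "'a list \<rightharpoonup> 'a list"
  proof -
    have "finite (- dom (f \<circ>\<^sub>m g))" "finite (- dom (f' \<circ>\<^sub>m g'))"
      using that tot_RM_fin_comp tot_RM_fin_iff by blast+
    then have "finite (sym_diff (dom (f \<circ>\<^sub>m g)) (dom (f' \<circ>\<^sub>m g')))"
      by (auto intro: rev_finite_subset)
    moreover have "(f \<circ>\<^sub>m g) x = (f' \<circ>\<^sub>m g') x"
      if "x \<in> dom (f \<circ>\<^sub>m g) \<inter> dom (f' \<circ>\<^sub>m g')" for x
    proof -
      from that obtain a b a' b' where y:
        "g x = Some a" "f a = Some b" "g' x = Some a'" "f' a' = Some b'"
        by (auto simp: map_comp_Some_iff)
      have "g x = g' x" using y e(2) unfolding equiv_fin_def by blast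
      then have "a = a'" using y by simp
      then have "f a = f' a" using y e(1) unfolding equiv_fin_def by blast
      then show ?thesis using y \<open>a = a'\<close> by simp
    qed
    ultimately show ?thesis by (simp add: equiv_fin_def)
  qed
  ultimately show ?thesis
    by (auto simp: monoid_congruence_def tot_RM_fin_monoid_def tot_RM_fin_comp)
qed

lemma quotient_monoid_mult:
  assumes r: "monoid_congruence M r" and "x \<in> carrier M" "y \<in> carrier M"
  shows "r `` {x} \<otimes>\<^bsub>quotient_monoid M r\<^esub> r `` {y} = r `` {x \<otimes>\<^bsub>M\<^esub> y}"
proof -
  have eq: "equiv (carrier M) r" using r by (simp add: monoid_congruence_def)
  have *: "r `` {x' \<otimes>\<^bsub>M\<^esub> y'} = r `` {x \<otimes>\<^bsub>M\<^esub> y}" if "(x, x') \<in> r" "(y, y') \<in> r" for x' y'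
  proof -
    have "(x \<otimes>\<^bsub>M\<^esub> y, x' \<otimes>\<^bsub>M\<^esub> y') \<in> r"
      using r that by (fastforce simp: monoid_congruence_def)
    then show ?thesis using equiv_class_eq[OF eq] by metis
  qed
  have "(x, x) \<in> r" "(y, y) \<in> r"
    using eq assms(2,3) by (auto simp: equiv_def refl_on_def)
  then have "(\<Union>x'\<in>r `` {x}. \<Union>y'\<in>r `` {y}. r `` {x' \<otimes>\<^bsub>M\<^esub> y'}) = r `` {x \<otimes>\<^bsub>M\<^esub> y}"
    using * by blast
  then show ?thesis by (simp add: quotient_monoid_def)
qed

lemma monoid_quotient_monoid:
  assumes M: "monoid M" and r: "monoid_congruence M r"
  shows "monoid (quotient_monoid M r)"
proof -
  interpret monoid M by fact
  note mult = quotient_monoid_mult[OF r]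
  have cls: "\<exists>x\<in>carrier M. X = r `` {x}" if "X \<in> carrier (quotient_monoid M r)" for X
    using that by (auto simp: quotient_monoid_def quotient_def)
  have carr: "r `` {x} \<in> carrier (quotient_monoid M r)" if "x \<in> carrier M" for x
    using that by (auto simp: quotient_monoid_def quotient_def)
  have one: "\<one>\<^bsub>quotient_monoid M r\<^esub> = r `` {\<one>\<^bsub>M\<^esub>}" by (simp add: quotient_monoid_def)
  show ?thesis
  proof (rule monoidI)
    show "\<one>\<^bsub>quotient_monoid M r\<^esub> \<in> carrier (quotient_monoid M r)"
      by (simp add: one carr)
  qed (auto dest!: cls simp: mult carr one m_assoc)
qed

lemma monoid_tot_M: "monoid (tot_M :: ('a::finite list \<rightharpoonup> 'a list) set monoid)"
  unfolding tot_M_def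
  by (rule monoid_quotient_monoid[OF monoid_tot_RM_fin monoid_congruence_equiv_fin])

end

theory Submission
  imports Defs
begin

text \<open>Congruences of a quotient monoid correspond to the congruences of the original monoid that
  contain the one divided out. The claim is therefore about a congruence \<open>s\<close> on the partial maps
  that properly contains \<open>equiv_fin\<close>, say \<open>(f, g) \<in> s\<close> where \<open>f\<close> and \<open>g\<close> differ at some string
  in both domains.

  Composing with left translations \<open>u \<mapsto> x @ u\<close>, which are total morphisms, localises this pair.
  If \<open>f\<close> and \<open>g\<close> take the values \<open>y\<close> and \<open>z\<close> at \<open>x\<close>, then \<open>s\<close> relates the translations by
  \<open>y\<close> and by \<open>z\<close>. Since there are two letters, \<open>x\<close> can be lengthened until \<open>y\<close> and \<open>z\<close> are not
  comparable for the prefix order (lemma \<open>ex_parallel_values\<close>). The cones \<open>y A\<^sup>*\<close> and \<open>z A\<^sup>*\<close>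
  are then disjoint, so for arbitrary \<open>h\<close> and \<open>k\<close> there is a single morphism that acts as \<open>h\<close> below
  \<open>y\<close> and as \<open>k\<close> below \<open>z\<close> (lemma \<open>ex_two_cone_morphism\<close>). Applying it after the two translations
  gives \<open>(h, k) \<in> s\<close>, so \<open>s\<close> is universal.\<close>

lemma monoid_congruence_preimage:
  assumes M: "monoid M" and r: "monoid_congruence M r"
    and R: "monoid_congruence (quotient_monoid M r) R"
  shows "monoid_congruence M {(x, y) \<in> carrier M \<times> carrier M. (r `` {x}, r `` {y}) \<in> R}"
proof -
  interpret monoid M by fact
  let ?Q = "quotient_monoid M r"
  have carr: "r `` {x} \<in> carrier ?Q" if "x \<in> carrier M" for x
    using that by (auto simp: quotient_monoid_def quotient_def)
  have R_equiv: "equiv (carrier ?Q) R"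
    using R by (simp add: monoid_congruence_def)
  have R_mult: "(X \<otimes>\<^bsub>?Q\<^esub> Y, X' \<otimes>\<^bsub>?Q\<^esub> Y') \<in> R" if "(X, X') \<in> R" "(Y, Y') \<in> R" for X X' Y Y'
    using R that by (fastforce simp: monoid_congruence_def)
  have "equiv (carrier M) {(x, y) \<in> carrier M \<times> carrier M. (r `` {x}, r `` {y}) \<in> R}"
  proof (rule equivI)
    show "refl_on (carrier M) {(x, y) \<in> carrier M \<times> carrier M. (r `` {x}, r `` {y}) \<in> R}"
      using R_equiv carr by (auto simp: refl_on_def equiv_def)
    show "sym {(x, y) \<in> carrier M \<times> carrier M. (r `` {x}, r `` {y}) \<in> R}"
      using R_equiv by (auto simp: equiv_def intro!: symI dest: symD)
    show "trans {(x, y) \<in> carrier M \<times> carrier M. (r `` {x}, r `` {y}) \<in> R}"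
      using R_equiv by (auto simp: equiv_def intro!: transI dest: transD)
  qed auto
  moreover have "(r `` {x \<otimes>\<^bsub>M\<^esub> y}, r `` {x' \<otimes>\<^bsub>M\<^esub> y'}) \<in> R"
    if "(r `` {x}, r `` {x'}) \<in> R" "(r `` {y}, r `` {y'}) \<in> R"
      "x \<in> carrier M" "x' \<in> carrier M" "y \<in> carrier M" "y' \<in> carrier M" for x x' y y'
    using R_mult[OF that(1,2)] that(3-) by (simp add: quotient_monoid_mult[OF r])
  ultimately show ?thesis
    unfolding monoid_congruence_def by auto
qed

lemma congruence_simple_quotientI:
  assumes M: "monoid M" and r: "monoid_congruence M r"
    and simple: "\<And>s. monoid_congruence M s \<Longrightarrow> r \<subseteq> s \<Longrightarrow> s = r \<or> s = carrier M \<times> carrier M"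
  shows "congruence_simple (quotient_monoid M r)"
proof -
  let ?Q = "quotient_monoid M r"
  have carr: "carrier ?Q = carrier M // r"
    by (simp add: quotient_monoid_def)
  have r_equiv: "equiv (carrier M) r"
    using r by (simp add: monoid_congruence_def)
  have "R = Id_on (carrier ?Q) \<or> R = carrier ?Q \<times> carrier ?Q"
    if R: "monoid_congruence ?Q R" for R
  proof -
    define s where "s = {(x, y) \<in> carrier M \<times> carrier M. (r `` {x}, r `` {y}) \<in> R}"
    have R_equiv: "equiv (carrier ?Q) R"
      using R by (simp add: monoid_congruence_def)
    then have R_sub: "R \<subseteq> carrier ?Q \<times> carrier ?Q"
      by (auto simp: equiv_def)
    have R_refl: "(X, X) \<in> R" if "X \<in> carrier ?Q" for X
      using R_equiv that by (auto simp: equiv_def refl_on_def)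
    have "monoid_congruence M s"
      unfolding s_def by (rule monoid_congruence_preimage[OF M r R])
    moreover have "r \<subseteq> s"
    proof
      fix e assume "e \<in> r"
      moreover obtain x y where e: "e = (x, y)" by fastforce
      ultimately have "r `` {x} = r `` {y}" "x \<in> carrier M" "y \<in> carrier M"
        using r_equiv equiv_class_eq[OF r_equiv] by (auto simp: equiv_def)
      moreover have "r `` {y} \<in> carrier ?Q"
        using \<open>y \<in> carrier M\<close> by (simp add: carr quotientI)
      ultimately show "e \<in> s"
        using R_refl by (simp add: s_def e)
    qed
    ultimately consider "s = r" | "s = carrier M \<times> carrier M"
      using simple by blast
    then show ?thesis
    proof cases
      case 1
      have "X = Y" if "(X, Y) \<in> R" for X Y
      proof -
        have "X \<in> carrier M // r" "Y \<in> carrier M // r"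
          using that R_sub by (auto simp: carr)
        then obtain x y where xy: "x \<in> carrier M" "y \<in> carrier M" "X = r `` {x}" "Y = r `` {y}"
          by (auto elim!: quotientE)
        then have "(x, y) \<in> r" using that 1 by (auto simp: s_def)
        then show ?thesis using xy equiv_class_eq[OF r_equiv] by simp
      qed
      then show ?thesis using R_sub R_refl by auto
    next
      case 2
      have "(X, Y) \<in> R" if XY: "X \<in> carrier ?Q" "Y \<in> carrier ?Q" for X Y
      proof -
        obtain x y where xy: "x \<in> carrier M" "y \<in> carrier M" "X = r `` {x}" "Y = r `` {y}"
          using XY by (auto simp: carr elim!: quotientE)
        then have "(x, y) \<in> s" using 2 by simp
        then show ?thesis using xy by (simp add: s_def)
      qed
      then show ?thesis using R_sub by auto
    qed
  qed
  then show ?thesis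
    using monoid_quotient_monoid[OF M r] by (simp add: congruence_simple_def)
qed

definition left_translation :: "'a list \<Rightarrow> 'a list \<rightharpoonup> 'a list" where
  "left_translation x = (\<lambda>u. Some (x @ u))"

lemma left_translation_tot_RM_fin: "left_translation (x :: 'a::finite list) \<in> tot_RM_fin"
  by (simp add: tot_RM_fin_iff right_ideal_morphism_iff left_translation_def dom_def)

lemma comp_left_translation:
  assumes "right_ideal_morphism f" "f x = Some y"
  shows "f \<circ>\<^sub>m left_translation x = left_translation y"
  using assms by (auto simp: right_ideal_morphism_iff left_translation_def map_comp_def)

text \<open>Different values of \<open>f\<close> and \<open>g\<close> at one string may be comparable, as \<open>v\<close> and \<open>v @ c # cs\<close>.
  Appending a letter \<open>b \<noteq> c\<close> to the argument turns them into \<open>v @ [b]\<close> and \<open>v @ c # cs @ [b]\<close>,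
  which branch after \<open>v\<close>.\<close>

lemma ex_parallel_values:
  assumes letters: "\<And>c :: 'a. \<exists>b. b \<noteq> c"
    and f: "right_ideal_morphism f" and g: "right_ideal_morphism g"
    and fx: "f x = Some y" and gx: "g x = Some (z :: 'a list)" and "y \<noteq> z"
  obtains x' y' z' where "f x' = Some y'" "g x' = Some z'" "y' \<parallel> z'"
proof -
  have branch: "\<exists>b. (v @ [b]) \<parallel> (w @ [b])" if vw: "strict_prefix v w" for v w :: "'a list"
  proof -
    obtain c cs where w: "w = v @ c # cs"
      using vw by (rule strict_prefixE')
    obtain b where "b \<noteq> c" using letters by blast
    then have "(v @ [b]) \<parallel> (w @ [b])" by (auto simp: w parallel_def)
    then show ?thesis ..
  qed
  have fxb: "f (x @ [b]) = Some (y @ [b])" and gxb: "g (x @ [b]) = Some (z @ [b])" for b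
    using f g fx gx by (auto simp: right_ideal_morphism_iff)
  consider "strict_prefix y z" | "strict_prefix z y" | "y \<parallel> z"
    using \<open>y \<noteq> z\<close> by (auto simp: parallel_def strict_prefix_def)
  then show ?thesis
  proof cases
    case 1
    then show ?thesis using branch fxb gxb that by blast
  next
    case 2
    then obtain b where "(z @ [b]) \<parallel> (y @ [b])" using branch by blast
    then show ?thesis using fxb gxb that parallel_commute by blast
  next
    case 3
    then show ?thesis using fx gx that by blast
  qed
qed

text \<open>Outside the two cones the morphism is the identity, restricted to strings at least as long as
  \<open>y\<close> and \<open>z\<close>. The restriction makes the domain a right ideal: such a string enters a cone
  by no extension unless it lies there already. It removes only finitely many strings.\<close>

lemma ex_two_cone_morphism:
  fixes h k :: "'a::finite list \<rightharpoonup> 'a list"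
  assumes h: "h \<in> tot_RM_fin" and k: "k \<in> tot_RM_fin" and par: "y \<parallel> z"
  obtains m where "m \<in> tot_RM_fin" "m \<circ>\<^sub>m left_translation y = h" "m \<circ>\<^sub>m left_translation z = k"
proof -
  define N where "N = max (length y) (length z)"
  define m where "m w = (if prefix y w then h (drop (length y) w)
    else if prefix z w then k (drop (length z) w)
    else if N \<le> length w then Some w else None)" for w
  have h': "h v = Some t \<Longrightarrow> h (v @ u) = Some (t @ u)"
    and k': "k v = Some t \<Longrightarrow> k (v @ u) = Some (t @ u)" for v t u
    using h k by (auto simp: tot_RM_fin_iff right_ideal_morphism_iff)
  have disjoint: "\<not> prefix y w" if "prefix z w" for w
    using par that prefix_same_cases by (auto simp: parallel_def)
  have on_y: "m (y @ u) = h u" for u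
    by (simp add: m_def)
  have on_z: "m (z @ u) = k u" for u
    using disjoint[of "z @ u"] by (simp add: m_def)
  have "m (w @ u) = Some (t @ u)" if w: "m w = Some t" for w t u
  proof -
    consider v where "w = y @ v" | v where "w = z @ v" | "\<not> prefix y w" "\<not> prefix z w"
      by (auto simp: prefix_def)
    then show ?thesis
    proof cases
      case 1
      then show ?thesis using w h' on_y by simp
    next
      case 2
      then show ?thesis using w k' on_z by simp
    next
      case 3
      then have t: "t = w" and long: "length y \<le> length w" "length z \<le> length w"
        using w by (auto simp: m_def N_def split: if_splits)
      then have "\<not> prefix y (w @ u)" "\<not> prefix z (w @ u)"
        using 3 prefix_length_prefix[of _ "w @ u" w] by auto
      then show ?thesis using t long by (auto simp: m_def N_def)
    qed
  qed
  then have "right_ideal_morphism m"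
    by (simp add: right_ideal_morphism_iff)
  moreover have "finite (- dom m)"
  proof (rule finite_subset)
    show "- dom m \<subseteq> (@) y ` (- dom h) \<union> (@) z ` (- dom k) \<union> {w. length w < N}"
    proof
      fix w assume w: "w \<in> - dom m"
      consider v where "w = y @ v" | v where "w = z @ v" | "\<not> prefix y w" "\<not> prefix z w"
        by (auto simp: prefix_def)
      then show "w \<in> (@) y ` (- dom h) \<union> (@) z ` (- dom k) \<union> {w. length w < N}"
      proof cases
        case 3
        then show ?thesis using w by (auto simp: m_def split: if_splits)
      qed (use w on_y on_z in auto)
    qed
    show "finite ((@) y ` (- dom h) \<union> (@) z ` (- dom k) \<union> {w. length w < N})"
      using h k finite_lists_length_less by (auto simp: tot_RM_fin_iff)
  qed
  ultimately have "m \<in> tot_RM_fin"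
    by (simp add: tot_RM_fin_iff)
  moreover have "m \<circ>\<^sub>m left_translation y = h" "m \<circ>\<^sub>m left_translation z = k"
    using on_y on_z by (auto simp: left_translation_def map_comp_def)
  ultimately show ?thesis by (rule that)
qed

lemma congruence_on_tot_RM_fin:
  assumes letters: "\<And>c :: 'a::finite. \<exists>b. b \<noteq> c"
    and s: "monoid_congruence (tot_RM_fin_monoid :: ('a list \<rightharpoonup> 'a list) monoid) s"
    and fg: "(f, g) \<in> s" "\<not> equiv_fin f g"
  shows "s = tot_RM_fin \<times> tot_RM_fin"
proof -
  have s_equiv: "equiv tot_RM_fin s"
    and s_comp: "\<And>a a' b b'. (a, a') \<in> s \<Longrightarrow> (b, b') \<in> s \<Longrightarrow> (a \<circ>\<^sub>m b, a' \<circ>\<^sub>m b') \<in> s"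
    using s by (fastforce simp: monoid_congruence_def tot_RM_fin_monoid_def)+
  then have s_sub: "s \<subseteq> tot_RM_fin \<times> tot_RM_fin"
    and s_refl: "\<And>a. a \<in> tot_RM_fin \<Longrightarrow> (a, a) \<in> s"
    by (auto simp: equiv_def refl_on_def)
  have mor: "right_ideal_morphism f" "right_ideal_morphism g"
    and fin: "finite (- dom f)" "finite (- dom g)"
    using fg(1) s_sub by (auto simp: tot_RM_fin_iff)
  have "finite (sym_diff (dom f) (dom g))"
    using fin by (auto intro: rev_finite_subset)
  then obtain x y z where "f x = Some y" "g x = Some z" "y \<noteq> z"
    using fg(2) by (fastforce simp: equiv_fin_def)
  then obtain x' y' z' where x': "f x' = Some y'" "g x' = Some z'" and par: "y' \<parallel> z'"
    using ex_parallel_values[OF letters mor] by metis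
  have "(f \<circ>\<^sub>m left_translation x', g \<circ>\<^sub>m left_translation x') \<in> s"
    using s_comp[OF fg(1) s_refl[OF left_translation_tot_RM_fin]] .
  then have trans: "(left_translation y', left_translation z') \<in> s"
    using comp_left_translation mor x' by metis
  have "(h, k) \<in> s" if hk: "h \<in> tot_RM_fin" "k \<in> tot_RM_fin" for h k
  proof -
    obtain m where "m \<in> tot_RM_fin"
      and "m \<circ>\<^sub>m left_translation y' = h" "m \<circ>\<^sub>m left_translation z' = k"
      using ex_two_cone_morphism[OF hk par] .
    then show ?thesis using s_comp[OF s_refl trans] by metis
  qed
  then show ?thesis using s_sub by auto
qed

theorem theorem7p3:
  assumes "CARD('a::finite) \<ge> 2"
  shows "congruence_simple (tot_M :: ('a list \<rightharpoonup> 'a list) set monoid)"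
proof -
  have letters: "\<exists>b. b \<noteq> c" for c :: 'a
  proof (rule ccontr)
    assume "\<not> (\<exists>b. b \<noteq> c)"
    then have "(UNIV :: 'a set) = {c}" by auto
    then have "CARD('a) = card {c}" by (rule arg_cong)
    then show False using assms by simp
  qed
  show ?thesis
    unfolding tot_M_def
  proof (rule congruence_simple_quotientI[OF monoid_tot_RM_fin monoid_congruence_equiv_fin])
    let ?r = "{(f, g :: 'a list \<rightharpoonup> 'a list). f \<in> tot_RM_fin \<and> g \<in> tot_RM_fin \<and> equiv_fin f g}"
    fix s
    assume s: "monoid_congruence (tot_RM_fin_monoid :: ('a list \<rightharpoonup> 'a list) monoid) s"
      and sub: "?r \<subseteq> s"
    have carr: "carrier (tot_RM_fin_monoid :: ('a list \<rightharpoonup> 'a list) monoid) = tot_RM_fin"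
      by (simp add: tot_RM_fin_monoid_def)
    have "s \<subseteq> tot_RM_fin \<times> tot_RM_fin"
      using s by (auto simp: monoid_congruence_def equiv_def carr)
    then have "s = ?r \<or> (\<exists>f g. (f, g) \<in> s \<and> \<not> equiv_fin f g)"
      using sub by blast
    then show "s = ?r \<or> s = carrier tot_RM_fin_monoid \<times> carrier tot_RM_fin_monoid"
      using congruence_on_tot_RM_fin[OF letters s] unfolding carr by blast
  qed
qed

end
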